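(* Let $\mathcal{R}$ be an associative ring with unit $1\neq 0$, let $a\in\mathcal{R}$ and let $\mathcal{S},\mathcal{T}$ be right ideals of $\mathcal{R}$. Then the following statements are equivalent: (1) $a^{(2)}_{{\rm rprin}=\mathcal{S},{\rm rann}=\mathcal{T}}$ exists, i.e. there is $x\in\mathcal{R}$ with $xax=x$, $x\mathcal{R}=\mathcal{S}$ and ${\rm rann}(x)=\mathcal{T}$. (2) There exists $x\in\mathcal{S}$ such that $\varphi_{ax}=\rho_{a\mathcal{S},\mathcal{T}}$, and ${\rm rann}(a)\cap\mathcal{S}=\{0\}$. (3) $\mathcal{R}=a\mathcal{S}\oplus\mathcal{T}$ and ${\rm rann}(a)\cap\mathcal{S}=\{0\}$. (4) There exists $x\in\mathcal{S}$ such that $xas=s$ for all $s\in\mathcal{S}$, $1-ax\in\mathcal{T}$, and $xt=0$ for all $t\in\mathcal{T}$.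
   Context: Notation: $a\mathcal{R}=\{ar:r\in\mathcal{R}\}$, $a\mathcal{S}=\{as:s\in\mathcal{S}\}$, ${\rm rann}(a)=\{r\in\mathcal{R}:ar=0\}$; $\varphi_a:\mathcal{R}\to\mathcal{R}$ is the additive group endomorphism $\varphi_a(r)=ar$. For additive subgroups $\mathcal{S},\mathcal{T}$ of $\mathcal{R}$, $\mathcal{R}=\mathcal{S}\oplus\mathcal{T}$ means $\mathcal{R}=\mathcal{S}+\mathcal{T}$ and $\mathcal{S}\cap\mathcal{T}=\{0\}$; in that case $\rho_{\mathcal{S},\mathcal{T}}:\mathcal{R}\to\mathcal{R}$ is the group endomorphism $\rho_{\mathcal{S},\mathcal{T}}(s+t)=s$ for $s\in\mathcal{S}$, $t\in\mathcal{T}$. Convention: whenever $\rho_{\mathcal{S},\mathcal{T}}$ is written, it is implicitly asserted that $\mathcal{R}=\mathcal{S}\oplus\mathcal{T}$. The symbol $a^{(2)}_{{\rm rprin}=\mathcal{S},{\rm rann}=\mathcal{T}}$ denotes the (unique, if it exists) $x\in\mathcal{R}$ with $xax=x$, $x\mathcal{R}=\mathcal{S}$, ${\rm rann}(x)=\mathcal{T}$. *)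

theory Defs
  imports Main "HOL-Library.Set_Algebras"
begin

text \<open>The ring \<open>\<R>\<close> is the whole type \<open>'a :: ring_1\<close> (associative, unital, \<open>0 \<noteq> 1\<close>). From
  Set_Algebras, \<open>a *o S\<close> is the set of all \<open>a * s\<close> with \<open>s \<in> S\<close>, so \<open>x\<R>\<close> is \<open>x *o UNIV\<close>,
  and \<open>S + T\<close> is the elementwise sum.\<close>

definition additive_subgroup :: "'a::ring_1 set \<Rightarrow> bool" where
  "additive_subgroup S \<longleftrightarrow> 0 \<in> S \<and> (\<forall>x\<in>S. \<forall>y\<in>S. x + y \<in> S) \<and> (\<forall>x\<in>S. - x \<in> S)"

definition right_ideal :: "'a::ring_1 set \<Rightarrow> bool" where
  "right_ideal S \<longleftrightarrow> additive_subgroup S \<and> (\<forall>x\<in>S. \<forall>r. x * r \<in> S)"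

definition rann :: "'a::ring_1 \<Rightarrow> 'a set" where
  "rann a = {r. a * r = 0}"

definition phi :: "'a::ring_1 \<Rightarrow> 'a \<Rightarrow> 'a" where
  "phi a = (\<lambda>r. a * r)"

text \<open>\<open>\<R> = S \<oplus> T\<close>, meant for additive subgroups \<open>S\<close> and \<open>T\<close>.\<close>

definition ring_direct_sum :: "'a::ring_1 set \<Rightarrow> 'a set \<Rightarrow> bool" where
  "ring_direct_sum S T \<longleftrightarrow> UNIV = S + T \<and> S \<inter> T = {0}"

text \<open>The projection onto \<open>S\<close> along \<open>T\<close>. Its value is meaningful only when
  \<open>ring_direct_sum S T\<close> holds, so that condition must be asserted wherever it is used.\<close>

definition rho :: "'a::ring_1 set \<Rightarrow> 'a set \<Rightarrow> 'a \<Rightarrow> 'a" where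
  "rho S T r = (THE s. s \<in> S \<and> (\<exists>t\<in>T. r = s + t))"

lemma rho_add:
  assumes S: "additive_subgroup S" and T: "additive_subgroup T"
    and ST: "ring_direct_sum S T" and s: "s \<in> S" and t: "t \<in> T"
  shows "rho S T (s + t) = s"
  unfolding rho_def
proof (rule the_equality)
  show "s \<in> S \<and> (\<exists>t'\<in>T. s + t = s + t')"
    using s t by blast
next
  fix s' assume "s' \<in> S \<and> (\<exists>t'\<in>T. s + t = s' + t')"
  then obtain t' where s': "s' \<in> S" and t': "t' \<in> T" and eq: "s + t = s' + t'"
    by blast
  have "s' + - s \<in> S"
    using S s s' unfolding additive_subgroup_def by blast
  moreover have "t + - t' \<in> T"
    using T t t' unfolding additive_subgroup_def by blast
  moreover have "s' + - s = t + - t'"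
    using eq by (simp add: algebra_simps)
  ultimately have "s' + - s \<in> S \<inter> T"
    by simp
  then have "s' + - s = 0"
    using ST unfolding ring_direct_sum_def by blast
  then show "s' = s"
    by simp
qed

text \<open>\<open>x\<close> is the outer inverse of \<open>a\<close> with principal right ideal \<open>S\<close> and right annihilator \<open>T\<close>.\<close>

definition outer_inverse_rprin_rann :: "'a::ring_1 \<Rightarrow> 'a set \<Rightarrow> 'a set \<Rightarrow> 'a \<Rightarrow> bool" where
  "outer_inverse_rprin_rann a S T x \<longleftrightarrow> x * a * x = x \<and> x *o UNIV = S \<and> rann x = T"

end

theory Submission
  imports Defs
begin

text \<open>
  Condition \<open>C4\<close> is the hub. It says that left multiplication by \<open>a\<close> maps \<open>S\<close>
  bijectively onto \<open>a S\<close> with inverse left multiplication by \<open>x\<close>, that \<open>x\<close> kills \<open>T\<close>, and that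
  \<open>1 = a x + (1 - a x)\<close> splits \<open>1\<close> along \<open>a S\<close> and \<open>T\<close>. Since \<open>S\<close> and \<open>T\<close> are right ideals,
  multiplying this splitting of \<open>1\<close> on the right by \<open>r\<close> splits every \<open>r\<close>. So \<open>a x\<close> acts as the
  projection onto \<open>a S\<close> along \<open>T\<close>, which is \<open>C2\<close>, and reading off range and kernel of \<open>x\<close> gives \<open>C1\<close>.

  Conversely, \<open>C3\<close> is turned into \<open>C4\<close> by decomposing the unit: if \<open>1 = a x + t\<close> with \<open>x \<in> S\<close> and
  \<open>t \<in> T\<close>, then for every \<open>r\<close> the elements \<open>a x r\<close> and \<open>t r\<close> are the components of \<open>r\<close>, and
  injectivity of \<open>a\<close> on \<open>S\<close> turns the resulting identities about \<open>a x\<close> into identities about \<open>x\<close>.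
\<close>

lemma additive_subgroup_diff:
  assumes "additive_subgroup S" "x \<in> S" "y \<in> S"
  shows "x - y \<in> S"
proof -
  have "x + - y \<in> S"
    using assms unfolding additive_subgroup_def by blast
  then show ?thesis by simp
qed

lemma additive_subgroup_elt_set_times:
  assumes S: "additive_subgroup S"
  shows "additive_subgroup (a *o S)"
proof -
  have "0 \<in> a *o S"
    using S set_times_intro2[of 0 S a] by (simp add: additive_subgroup_def)
  moreover have "a * u + a * v \<in> a *o S" if "u \<in> S" "v \<in> S" for u v
    using that S set_times_intro2[of "u + v" S a]
    by (simp add: additive_subgroup_def distrib_left)
  moreover have "- (a * u) \<in> a *o S" if "u \<in> S" for u
    using that S set_times_intro2[of "- u" S a] by (simp add: additive_subgroup_def)
  ultimately show ?thesis
    unfolding additive_subgroup_def by (auto simp: elt_set_times_def)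
qed

lemma right_ideal_imp_additive_subgroup: "right_ideal S \<Longrightarrow> additive_subgroup S"
  by (simp add: right_ideal_def)

lemma right_ideal_mult: "right_ideal S \<Longrightarrow> x \<in> S \<Longrightarrow> x * r \<in> S"
  by (simp add: right_ideal_def)

definition local_inverse_along :: "'a::ring_1 \<Rightarrow> 'a set \<Rightarrow> 'a set \<Rightarrow> 'a \<Rightarrow> bool" where
  "local_inverse_along a S T x \<longleftrightarrow>
     x \<in> S \<and> (\<forall>s\<in>S. x * a * s = s) \<and> 1 - a * x \<in> T \<and> (\<forall>t\<in>T. x * t = 0)"

text \<open>Given the prescribed range and annihilator, \<open>x a x = x\<close> says both that \<open>x a\<close> fixes the
  generator \<open>x\<close> of \<open>x \<R> = S\<close>, hence all of \<open>S\<close>, and that \<open>x\<close> kills \<open>1 - a x\<close>. Backwards, \<open>x r = 0\<close> forces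
  \<open>r = (1 - a x) r \<in> T\<close>.\<close>

lemma outer_inverse_iff_local_inverse_along:
  assumes S: "right_ideal S" and T: "right_ideal T"
  shows "outer_inverse_rprin_rann a S T x \<longleftrightarrow> local_inverse_along a S T x"
proof
  assume "outer_inverse_rprin_rann a S T x"
  then have xax: "x * a * x = x" and range: "x *o UNIV = S" and rann: "rann x = T"
    by (auto simp: outer_inverse_rprin_rann_def)
  have "x \<in> S"
    using range set_times_intro2[of 1 UNIV x] by simp
  moreover have "x * a * s = s" if s: "s \<in> S" for s
  proof -
    obtain r where "s = x * r"
      using s range unfolding elt_set_times_def by blast
    then have "x * a * s = (x * a * x) * r"
      by (simp add: mult.assoc)
    with xax \<open>s = x * r\<close> show ?thesis by simp
  qed
  moreover have "1 - a * x \<in> T"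
    using rann xax by (auto simp: rann_def algebra_simps)
  moreover have "\<forall>t\<in>T. x * t = 0"
    using rann by (auto simp: rann_def)
  ultimately show "local_inverse_along a S T x"
    by (simp add: local_inverse_along_def)
next
  assume "local_inverse_along a S T x"
  then have x: "x \<in> S" and fixes_S: "\<And>s. s \<in> S \<Longrightarrow> x * a * s = s"
    and unit: "1 - a * x \<in> T" and kills_T: "\<And>t. t \<in> T \<Longrightarrow> x * t = 0"
    by (auto simp: local_inverse_along_def)
  have "x *o UNIV = S"
  proof
    show "x *o UNIV \<subseteq> S"
      using right_ideal_mult[OF S x] by (auto simp: elt_set_times_def)
    show "S \<subseteq> x *o UNIV"
    proof
      fix s assume "s \<in> S"
      then have "s = x * (a * s)"
        using fixes_S by (simp add: mult.assoc)
      then show "s \<in> x *o UNIV"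
        by (auto simp: elt_set_times_def)
    qed
  qed
  moreover have "rann x = T"
  proof
    show "rann x \<subseteq> T"
    proof
      fix r assume "r \<in> rann x"
      then have "(1 - a * x) * r = r"
        by (simp add: rann_def left_diff_distrib mult.assoc)
      then show "r \<in> T"
        using right_ideal_mult[OF T unit, of r] by simp
    qed
    show "T \<subseteq> rann x"
      using kills_T by (auto simp: rann_def)
  qed
  ultimately show "outer_inverse_rprin_rann a S T x"
    using fixes_S[OF x] by (simp add: outer_inverse_rprin_rann_def)
qed

text \<open>Right multiplication of \<open>1 = a x + (1 - a x)\<close> by \<open>r\<close> gives the components of \<open>r\<close>. Both
  intersections are trivial because \<open>s = x (a s)\<close> vanishes as soon as \<open>x\<close> kills \<open>a s\<close>.\<close>

lemma local_inverse_along_imp_projection: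
  assumes S: "right_ideal S" and T: "right_ideal T" and "local_inverse_along a S T x"
  shows "ring_direct_sum (a *o S) T" and "rann a \<inter> S = {0}"
    and "phi (a * x) = rho (a *o S) T"
proof -
  have x: "x \<in> S" and fixes_S: "\<And>s. s \<in> S \<Longrightarrow> x * a * s = s"
    and unit: "1 - a * x \<in> T" and kills_T: "\<And>t. t \<in> T \<Longrightarrow> x * t = 0"
    using assms(3) by (auto simp: local_inverse_along_def)
  note addS = right_ideal_imp_additive_subgroup[OF S]
  note addT = right_ideal_imp_additive_subgroup[OF T]
  note addaS = additive_subgroup_elt_set_times[OF addS, of a]
  have in_aS: "a * x * r \<in> a *o S" for r
    using set_times_intro2[OF right_ideal_mult[OF S x], of a r] by (simp add: mult.assoc)
  have in_T: "(1 - a * x) * r \<in> T" for r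
    by (rule right_ideal_mult[OF T unit])
  have split: "a * x * r + (1 - a * x) * r = r" for r
    by (simp add: left_diff_distrib)
  have "a *o S + T = UNIV"
  proof -
    have "r \<in> a *o S + T" for r
      using set_plus_intro[OF in_aS[of r] in_T[of r]] by (simp only: split)
    then show ?thesis by blast
  qed
  moreover have "a *o S \<inter> T = {0}"
  proof -
    have "a * s = 0" if "s \<in> S" "a * s \<in> T" for s
      using fixes_S[OF that(1)] kills_T[OF that(2)] by (simp add: mult.assoc)
    then show ?thesis
      using addaS addT by (auto simp: additive_subgroup_def elt_set_times_def)
  qed
  ultimately show sum: "ring_direct_sum (a *o S) T"
    by (simp add: ring_direct_sum_def)
  have "s = 0" if "s \<in> S" "a * s = 0" for s
    using fixes_S[OF that(1)] that(2) by (simp add: mult.assoc)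
  then show "rann a \<inter> S = {0}"
    using addS by (auto simp: rann_def additive_subgroup_def)
  show "phi (a * x) = rho (a *o S) T"
  proof
    fix r
    show "phi (a * x) r = rho (a *o S) T r"
      using rho_add[OF addaS addT sum in_aS in_T, of r r] by (simp add: split phi_def)
  qed
qed

text \<open>The witness is the \<open>a S\<close>-component \<open>a x\<close> of \<open>1 = a x + t\<close>. For \<open>r \<in> T\<close> the component
  \<open>a x r = r - t r\<close> also lies in \<open>T\<close>, and for \<open>r = a s\<close> the component \<open>t a s = a s - a x a s\<close> also
  lies in \<open>a S\<close>; both are therefore zero, and \<open>a\<close> can be cancelled on \<open>S\<close>.\<close>

lemma direct_sum_imp_local_inverse_along:
  assumes S: "right_ideal S" and T: "right_ideal T"
    and sum: "ring_direct_sum (a *o S) T" and inj: "rann a \<inter> S = {0}"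
  shows "\<exists>x. local_inverse_along a S T x"
proof -
  note addS = right_ideal_imp_additive_subgroup[OF S]
  note addT = right_ideal_imp_additive_subgroup[OF T]
  have disjoint: "a * s = 0" if "s \<in> S" "a * s \<in> T" for s
    using sum set_times_intro2[OF that(1), of a] that(2) unfolding ring_direct_sum_def by blast
  have cancel: "s = 0" if "s \<in> S" "a * s = 0" for s
    using inj that by (auto simp: rann_def)
  have "1 \<in> a *o S + T"
    using sum unfolding ring_direct_sum_def by blast
  then obtain x t where x: "x \<in> S" and t: "t \<in> T" and one: "1 = a * x + t"
    by (auto simp: elt_set_times_def elim!: set_plus_elim)
  have t_eq: "1 - a * x = t"
    using one by (simp add: algebra_simps)
  have kills_T: "x * r = 0" if "r \<in> T" for r
  proof -
    have "a * (x * r) = r - t * r"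
      unfolding t_eq[symmetric] by (simp add: left_diff_distrib mult.assoc)
    also have "\<dots> \<in> T"
      using additive_subgroup_diff[OF addT that right_ideal_mult[OF T t]] .
    finally show ?thesis
      using disjoint cancel right_ideal_mult[OF S x] by blast
  qed
  have fixes_S: "x * a * s = s" if s: "s \<in> S" for s
  proof -
    have diff: "s - x * (a * s) \<in> S"
      using additive_subgroup_diff[OF addS s right_ideal_mult[OF S x]] .
    have "a * (s - x * (a * s)) = t * (a * s)"
      unfolding t_eq[symmetric] by (simp add: algebra_simps)
    also have "\<dots> \<in> T"
      by (rule right_ideal_mult[OF T t])
    finally have "s - x * (a * s) = 0"
      using disjoint cancel diff by blast
    then show ?thesis
      by (simp add: mult.assoc)
  qed
  show ?thesis
    using x t kills_T fixes_S by (auto simp: local_inverse_along_def t_eq)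
qed

theorem theorem5p3:
  fixes a :: "'a::ring_1" and S T :: "'a set"
  assumes "right_ideal S" and "right_ideal T"
  defines "C1 \<equiv> (\<exists>x. outer_inverse_rprin_rann a S T x)"
    and "C2 \<equiv> (\<exists>x\<in>S. ring_direct_sum (a *o S) T \<and> phi (a * x) = rho (a *o S) T) \<and> rann a \<inter> S = {0}"
    and "C3 \<equiv> ring_direct_sum (a *o S) T \<and> rann a \<inter> S = {0}"
    and "C4 \<equiv> (\<exists>x\<in>S. (\<forall>s\<in>S. x * a * s = s) \<and> 1 - a * x \<in> T \<and> (\<forall>t\<in>T. x * t = 0))"
  shows "(C1 \<longleftrightarrow> C2) \<and> (C2 \<longleftrightarrow> C3) \<and> (C3 \<longleftrightarrow> C4)"
proof -
  have C4_iff: "C4 \<longleftrightarrow> (\<exists>x. local_inverse_along a S T x)"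
    unfolding C4_def local_inverse_along_def by blast
  have "C1 \<longleftrightarrow> C4"
    unfolding C1_def C4_iff outer_inverse_iff_local_inverse_along[OF assms(1,2)] ..
  moreover have "C4 \<Longrightarrow> C2"
  proof -
    assume C4
    then obtain x where x: "local_inverse_along a S T x"
      unfolding C4_iff by blast
    then have "x \<in> S"
      by (simp add: local_inverse_along_def)
    then show C2
      unfolding C2_def using local_inverse_along_imp_projection[OF assms(1,2) x] by blast
  qed
  moreover have "C2 \<Longrightarrow> C3"
    unfolding C2_def C3_def by blast
  moreover have "C3 \<Longrightarrow> C4"
    unfolding C3_def C4_iff using direct_sum_imp_local_inverse_along[OF assms(1,2)] by blast
  ultimately show ?thesis
    by blast
qed

end
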